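(* Let $m$ and $n$ be powers of $2$ with $m \ge 16$, $n \ge 4$ and $m \le 4n$, and let $$G = G(m,n) := \langle a, b \mid a^m = 1,\ b^n = 1,\ [b,a] = a^4 \rangle.$$ Then $G$ does not satisfy property $( * )$. Consequently, there are infinitely many finite $2$-groups that do not satisfy $( * )$.
   Context: Commutators are $[x,y] = x^{-1}y^{-1}xy$. An involution is an element of order exactly $2$. A finite group $G$ satisfies property $( * )$ if there exist a group $\Gamma$ generated by involutions and a subgroup of index $2$ in $\Gamma$ that is isomorphic to $G$. *)

theory Defs
  imports "HOL-Algebra.Algebra"
begin

datatype gen = GA | GB

text \<open>A letter is a generator together with a flag: False = the generator, True = its inverse.
  Words are lists of letters (elements of the free monoid on a, a^-1, b, b^-1).\<close>

type_synonym letter = "gen \<times> bool"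
type_synonym word = "letter list"

definition inv_letter :: "letter \<Rightarrow> letter" where
  "inv_letter x = (fst x, \<not> snd x)"

definition inv_word :: "word \<Rightarrow> word" where
  "inv_word w = rev (map inv_letter w)"

inductive word_eq :: "word set \<Rightarrow> word \<Rightarrow> word \<Rightarrow> bool" for R where
  refl: "word_eq R u u"
| sym: "word_eq R u v \<Longrightarrow> word_eq R v u"
| trans: "word_eq R u v \<Longrightarrow> word_eq R v w \<Longrightarrow> word_eq R u w"
| cancel: "word_eq R (u @ [x, inv_letter x] @ v) (u @ v)"
| relator: "r \<in> R \<Longrightarrow> word_eq R (u @ r @ v) (u @ v)"

definition word_rel :: "word set \<Rightarrow> (word \<times> word) set" where
  "word_rel R = {(u, v). word_eq R u v}"

definition word_class_mult :: "word set \<Rightarrow> word set \<Rightarrow> word set \<Rightarrow> word set" where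
  "word_class_mult R P Q = (\<Union>u\<in>P. \<Union>v\<in>Q. word_rel R `` {u @ v})"

definition presented_group :: "word set \<Rightarrow> word set monoid" where
  "presented_group R =
     \<lparr> carrier = UNIV // word_rel R,
       monoid.mult = word_class_mult R,
       monoid.one = word_rel R `` {[]} \<rparr>"

text \<open>Relators of G(m,n) = < a, b | a^m = 1, b^n = 1, [b,a] = a^4 >, with
  [x,y] = x^-1 y^-1 x y, so the third relator is b^-1 a^-1 b a a^-4.\<close>

definition Gmn_relators :: "nat \<Rightarrow> nat \<Rightarrow> word set" where
  "Gmn_relators m n =
     { replicate m (GA, False),
       replicate n (GB, False),
       [(GB, True), (GA, True), (GB, False), (GA, False)] @ replicate 4 (GA, True) }"

definition Gmn :: "nat \<Rightarrow> nat \<Rightarrow> word set monoid" where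
  "Gmn m n = presented_group (Gmn_relators m n)"

definition involution :: "('g, 'b) monoid_scheme \<Rightarrow> 'g \<Rightarrow> bool" where
  "involution \<Gamma> x \<longleftrightarrow> x \<in> carrier \<Gamma> \<and> x \<noteq> \<one>\<^bsub>\<Gamma>\<^esub> \<and> x \<otimes>\<^bsub>\<Gamma>\<^esub> x = \<one>\<^bsub>\<Gamma>\<^esub>"

text \<open>G satisfies (*) witnessed by the group Gamma: Gamma is generated by involutions and has a
  subgroup of index 2 isomorphic to G. Property (*) itself is existence of such a Gamma of
  some type; its negation is stated by quantifying over Gamma of an arbitrary type.\<close>

definition star_witness :: "('a, 'c) monoid_scheme \<Rightarrow> 'g monoid \<Rightarrow> bool" where
  "star_witness G \<Gamma> \<longleftrightarrow>
     group \<Gamma> \<and> generate \<Gamma> {x. involution \<Gamma> x} = carrier \<Gamma> \<and>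
     (\<exists>H. subgroup H \<Gamma> \<and> card (rcosets\<^bsub>\<Gamma>\<^esub> H) = 2 \<and> G \<cong> \<Gamma>\<lparr>carrier := H\<rparr>)"

end

theory Submission
  imports Defs "HOL-Number_Theory.Cong"
begin

text \<open>If \<open>G\<close> has index 2 in a group generated by involutions, then conjugation by an involution
  outside \<open>G\<close> is an automorphism \<open>\<alpha>\<close> of \<open>G\<close> with \<open>\<alpha>\<^sup>2 = 1\<close>, and \<open>G\<close> is generated by its elements of
  order at most 2 together with the elements inverted by \<open>\<alpha>\<close>. For \<open>G = G(m,n)\<close> the former are
  trivial modulo \<open>G' = \<langle>a\<^sup>4\<rangle>\<close> or congruent to \<open>b\<^bsup>n/2\<^esup>\<close>, so \<open>\<alpha>\<close> inverts \<open>G/G'\<close>. Hence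
  \<open>\<alpha>(a) \<in> \<langle>a\<rangle>\<close> is a generator of \<open>\<langle>a\<rangle>\<close> and \<open>\<alpha>(b)\<close> acts on \<open>\<langle>a\<rangle>\<close> like \<open>b\<^sup>-\<^sup>1\<close>; applying \<open>\<alpha>\<close> to
  \<open>b\<^sup>-\<^sup>1 a b = a\<^sup>-\<^sup>3\<close> shows that \<open>b\<close> and \<open>b\<^sup>-\<^sup>1\<close> act on \<open>\<langle>a\<rangle>\<close> by the same power, so that
  \<open>9 \<equiv> 1\<close> modulo \<open>m\<close>, contradicting \<open>m \<ge> 16\<close>.\<close>

section \<open>Subgroups of index 2 in groups generated by involutions\<close>

text \<open>Neither \<open>H #> x\<close> nor \<open>H #> y\<close> is \<open>H\<close>, and only
  one other coset exists, so the two coincide.\<close>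

lemma (in group) index_2_mult_inv_mem:
  assumes H: "subgroup H G" and index: "card (rcosets H) = 2"
    and x: "x \<in> carrier G" "x \<notin> H" and y: "y \<in> carrier G" "y \<notin> H"
  shows "x \<otimes> inv y \<in> H"
proof -
  have HG: "H \<subseteq> carrier G" using H by (rule subgroup.subset)
  have "H #> x \<noteq> H" "H #> y \<noteq> H"
    using coset_join1[OF _ x(1) H] coset_join1[OF _ y(1) H] x y by blast+
  moreover have "H \<in> rcosets H" "H #> x \<in> rcosets H" "H #> y \<in> rcosets H"
    using rcosetsI[OF HG] x y subgroup.subgroup_in_rcosets[OF H is_group] by auto
  ultimately have "H #> x = H #> y"
    using index by (auto simp: card_2_iff)
  then show ?thesis
    using subgroup.rcos_module_imp[OF H is_group y(1)] rcos_self[OF x(1) H] by simp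
qed

text \<open>Since \<open>t\<close> normalises \<open>K\<close> and is its own inverse, the union of
  \<open>K\<close> and its coset \<open>K t\<close> is a subgroup. It contains all involutions,
  hence is the whole group; as \<open>t\<close> lies outside \<open>H\<close>, its intersection with
  \<open>H\<close> is just \<open>K\<close>.\<close>

lemma (in group) subgroup_index_2_eq:
  assumes H: "subgroup H G" and index: "card (rcosets H) = 2"
    and gen: "generate G {x. involution G x} = carrier G"
    and t: "t \<in> carrier G" "t \<notin> H" "t \<otimes> t = \<one>"
    and K: "subgroup K G" "K \<subseteq> H" "\<And>x. x \<in> K \<Longrightarrow> t \<otimes> x \<otimes> t \<in> K"
    and inH: "\<And>x. x \<in> H \<Longrightarrow> x \<otimes> x = \<one> \<Longrightarrow> x \<in> K"
    and outH: "\<And>x. x \<in> H \<Longrightarrow> t \<otimes> x \<otimes> t = inv x \<Longrightarrow> x \<in> K"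
  shows "K = H"
proof -
  \<comment> \<open>Because \<open>t\<close> is its own inverse,
    \<open>x \<otimes> t \<in> K\<close> says that \<open>x\<close> lies in the coset
    \<open>K t\<close>.\<close>
  define L where "L = {x \<in> carrier G. x \<in> K \<or> x \<otimes> t \<in> K}"
  have inv_t: "inv t = t"
    using t by (simp add: inv_equality)
  have tt: "t \<otimes> (t \<otimes> x) = x" if "x \<in> carrier G" for x
    using that t by (simp flip: m_assoc)
  have KG: "x \<in> carrier G" if "x \<in> K" for x
    using that K(1) subgroup.mem_carrier by metis
  have Kc: "t \<otimes> (x \<otimes> t) \<in> K" if "x \<in> K" for x
    using K(3)[OF that] KG[OF that] t(1) by (simp add: m_assoc)
  have L: "subgroup L G"
  proof (rule subgroupI)
    show "L \<subseteq> carrier G" by (auto simp: L_def)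
    show "L \<noteq> {}" using subgroup.one_closed[OF K(1)] by (auto simp: L_def)
  next
    fix x assume x: "x \<in> L"
    show "inv x \<in> L"
    proof (cases "x \<in> K")
      case True
      then show ?thesis using subgroup.m_inv_closed[OF K(1)] KG by (auto simp: L_def)
    next
      case False
      then have xt: "x \<in> carrier G" "x \<otimes> t \<in> K" using x by (auto simp: L_def)
      from xt have "t \<otimes> (inv (x \<otimes> t) \<otimes> t) \<in> K"
        using subgroup.m_inv_closed[OF K(1)] Kc by blast
      also have "t \<otimes> (inv (x \<otimes> t) \<otimes> t) = inv x \<otimes> t"
        using xt t(1) by (simp add: inv_mult_group inv_t m_assoc tt)
      finally show ?thesis using xt by (auto simp: L_def)
    qed
  next
    fix x y assume xy: "x \<in> L" "y \<in> L"
    then have c: "x \<in> carrier G" "y \<in> carrier G" by (auto simp: L_def)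
    note mK = subgroup.m_closed[OF K(1)]
    consider "x \<in> K" "y \<in> K" | "x \<in> K" "y \<otimes> t \<in> K" | "x \<otimes> t \<in> K" "y \<in> K"
      | "x \<otimes> t \<in> K" "y \<otimes> t \<in> K"
      using xy by (auto simp: L_def)
    then show "x \<otimes> y \<in> L"
    proof cases
      case 1
      then show ?thesis using c mK by (auto simp: L_def)
    next
      case 2
      then show ?thesis using c t(1) mK[of x "y \<otimes> t"] by (auto simp: L_def m_assoc)
    next
      case 3
      then show ?thesis using c t(1) mK[OF 3(1) Kc[OF 3(2)]] by (auto simp: L_def m_assoc tt)
    next
      case 4
      then show ?thesis using c t mK[OF 4(1) Kc[OF 4(2)]] by (auto simp: L_def m_assoc tt)
    qed
  qed
  have "x \<in> L" if "involution G x" for x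
  proof (cases "x \<in> H")
    case True
    then show ?thesis using that inH by (auto simp: L_def involution_def)
  next
    case False
    have x: "x \<in> carrier G" "x \<otimes> x = \<one>" using that by (auto simp: involution_def)
    then have "inv x = x" by (simp add: inv_equality)
    \<comment> \<open>A product of two involutions is inverted under conjugation by either factor;
      here both sides are \<open>t \<otimes> x\<close>. So an involution outside \<open>H\<close> is
      an element to which \<open>outH\<close> applies, times \<open>t\<close>.\<close>
    then have "t \<otimes> (x \<otimes> t) \<otimes> t = inv (x \<otimes> t)"
      using x t by (simp add: inv_mult_group inv_t m_assoc)
    moreover have "x \<otimes> t \<in> H"
      using index_2_mult_inv_mem[OF H index x(1) False t(1,2)] by (simp add: inv_t)
    ultimately show ?thesis using outH x by (auto simp: L_def)
  qed
  then have "carrier G \<subseteq> L"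
    using generate_subgroup_incl[OF _ L, of "{x. involution G x}"] gen by auto
  have "x \<in> K" if x: "x \<in> H" for x
  proof (rule ccontr)
    have xG: "x \<in> carrier G" using x H subgroup.mem_carrier by metis
    assume "x \<notin> K"
    then have "x \<otimes> t \<in> H" using \<open>carrier G \<subseteq> L\<close> xG K(2) by (auto simp: L_def)
    \<comment> \<open>Cancelling \<open>x\<close> would put \<open>t\<close> itself into
      \<open>H\<close>.\<close>
    then have "inv x \<otimes> (x \<otimes> t) \<in> H"
      using x H subgroup.m_closed subgroup.m_inv_closed by metis
    then show False using t xG by (simp flip: m_assoc)
  qed
  then show ?thesis using K(2) by blast
qed

text \<open>Conjugation by an involution \<open>t\<close> outside the index 2 subgroup is carried
  over to \<open>G\<close> along the isomorphism. The subgroup generated by the listed elements is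
  stable under \<alpha>, so \<open>subgroup_index_2_eq\<close> applies to its image.\<close>

lemma star_witness_automorphism:
  fixes \<Gamma> :: "'g monoid"
  assumes G: "group G" and star: "star_witness G \<Gamma>"
  obtains \<alpha> where "\<alpha> \<in> hom G G" "\<And>x. x \<in> carrier G \<Longrightarrow> \<alpha> (\<alpha> x) = x"
    "generate G {x \<in> carrier G. x \<otimes>\<^bsub>G\<^esub> x = \<one>\<^bsub>G\<^esub> \<or> \<alpha> x = inv\<^bsub>G\<^esub> x} = carrier G"
proof -
  interpret G: group G by (rule G)
  obtain H \<phi> where \<Gamma>: "group \<Gamma>" and gen: "generate \<Gamma> {x. involution \<Gamma> x} = carrier \<Gamma>"
    and H: "subgroup H \<Gamma>" and index: "card (rcosets\<^bsub>\<Gamma>\<^esub> H) = 2"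
    and \<phi>: "\<phi> \<in> iso G (\<Gamma>\<lparr>carrier := H\<rparr>)"
    using star unfolding star_witness_def is_iso_def by blast
  interpret \<Gamma>: group \<Gamma> by (rule \<Gamma>)
  have HG: "x \<in> carrier \<Gamma>" if "x \<in> H" for x using that H subgroup.mem_carrier by metis
  have "\<exists>t. involution \<Gamma> t \<and> t \<notin> H"
  proof (rule ccontr)
    \<comment> \<open>A subgroup containing all involutions would be all of \<Gamma> and have a
      single coset.\<close>
    assume "\<nexists>t. involution \<Gamma> t \<and> t \<notin> H"
    then have "carrier \<Gamma> \<subseteq> H"
      using \<Gamma>.generate_subgroup_incl[OF _ H, of "{x. involution \<Gamma> x}"] gen by auto
    then have "rcosets\<^bsub>\<Gamma>\<^esub> H \<subseteq> {H}"
      using \<Gamma>.coset_join2[OF _ H] by (auto simp: RCOSETS_def)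
    then have "card (rcosets\<^bsub>\<Gamma>\<^esub> H) \<le> card {H}" by (intro card_mono) auto
    then show False using index by simp
  qed
  then obtain t where t: "t \<in> carrier \<Gamma>" "t \<notin> H" "t \<otimes>\<^bsub>\<Gamma>\<^esub> t = \<one>\<^bsub>\<Gamma>\<^esub>"
    by (auto simp: involution_def)
  define \<sigma> where "\<sigma> x = t \<otimes>\<^bsub>\<Gamma>\<^esub> x \<otimes>\<^bsub>\<Gamma>\<^esub> t" for x
  have inv_t: "inv\<^bsub>\<Gamma>\<^esub> t = t"
    using t by (simp add: \<Gamma>.inv_equality)
  have tt: "t \<otimes>\<^bsub>\<Gamma>\<^esub> (t \<otimes>\<^bsub>\<Gamma>\<^esub> x) = x" if "x \<in> carrier \<Gamma>" for x
    using that t by (simp flip: \<Gamma>.m_assoc)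
  have \<sigma>H: "\<sigma> x \<in> H" if x: "x \<in> H" for x
  proof -
    \<comment> \<open>Both \<open>t x\<close> and \<open>t\<close> lie outside \<open>H\<close>, so
      index 2 brings \<open>t x t\<close> back into \<open>H\<close>.\<close>
    have "t \<otimes>\<^bsub>\<Gamma>\<^esub> x \<notin> H"
    proof
      assume "t \<otimes>\<^bsub>\<Gamma>\<^esub> x \<in> H"
      then have "t \<otimes>\<^bsub>\<Gamma>\<^esub> x \<otimes>\<^bsub>\<Gamma>\<^esub> inv\<^bsub>\<Gamma>\<^esub> x \<in> H"
        using x H subgroup.m_closed subgroup.m_inv_closed by metis
      then show False using t HG[OF x] by (simp add: \<Gamma>.m_assoc)
    qed
    then show ?thesis
      using \<Gamma>.index_2_mult_inv_mem[OF H index _ _ t(1,2), of "t \<otimes>\<^bsub>\<Gamma>\<^esub> x"] t(1) HG[OF x]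
      by (simp add: inv_t \<sigma>_def)
  qed
  have \<sigma>m: "\<sigma> (x \<otimes>\<^bsub>\<Gamma>\<^esub> y) = \<sigma> x \<otimes>\<^bsub>\<Gamma>\<^esub> \<sigma> y" if "x \<in> H" "y \<in> H" for x y
    using HG[OF that(1)] HG[OF that(2)] t by (simp add: \<sigma>_def \<Gamma>.m_assoc tt)
  have \<sigma>\<sigma>: "\<sigma> (\<sigma> x) = x" if "x \<in> H" for x
    using HG[OF that] t by (simp add: \<sigma>_def \<Gamma>.m_assoc tt)

  let ?H = "\<Gamma>\<lparr>carrier := H\<rparr>"
  interpret H: group ?H by (rule \<Gamma>.subgroup_imp_group[OF H])
  define \<psi> where "\<psi> = inv_into (carrier G) \<phi>"
  have \<psi>: "\<psi> \<in> iso ?H G" unfolding \<psi>_def by (rule G.iso_set_sym[OF \<phi>])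
  interpret \<phi>: group_hom G ?H \<phi>
    using \<phi> by unfold_locales (simp add: iso_imp_homomorphism)
  interpret \<psi>: group_hom ?H G \<psi>
    using \<psi> by unfold_locales (simp add: iso_imp_homomorphism)
  have \<psi>\<phi>: "\<psi> (\<phi> x) = x" if "x \<in> carrier G" for x
    using that \<phi> unfolding \<psi>_def iso_iff by (simp add: inv_into_f_f)
  have \<phi>\<psi>: "\<phi> (\<psi> x) = x" if "x \<in> H" for x
    using that \<phi> unfolding \<psi>_def iso_iff by (simp add: f_inv_into_f)
  have \<phi>H: "\<phi> x \<in> H" if "x \<in> carrier G" for x using \<phi>.hom_closed[OF that] by simp
  have \<psi>G: "\<psi> x \<in> carrier G" if "x \<in> H" for x using \<psi>.hom_closed[of x] that by simp
  define \<alpha> where "\<alpha> x = \<psi> (\<sigma> (\<phi> x))" for x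
  have \<alpha>: "\<alpha> \<in> hom G G"
  proof (rule homI)
    show "\<alpha> x \<in> carrier G" if "x \<in> carrier G" for x
      using that by (simp add: \<alpha>_def \<psi>G \<sigma>H \<phi>H)
    show "\<alpha> (x \<otimes>\<^bsub>G\<^esub> y) = \<alpha> x \<otimes>\<^bsub>G\<^esub> \<alpha> y" if "x \<in> carrier G" "y \<in> carrier G" for x y
      using that \<psi>.hom_mult[of "\<sigma> (\<phi> x)" "\<sigma> (\<phi> y)"] \<phi>.hom_mult[of x y]
      by (simp add: \<alpha>_def \<sigma>m \<sigma>H \<phi>H)
  qed
  interpret \<alpha>: group_hom G G \<alpha> using \<alpha> by unfold_locales
  have \<alpha>\<alpha>: "\<alpha> (\<alpha> x) = x" if "x \<in> carrier G" for x
    using that by (simp add: \<alpha>_def \<phi>\<psi> \<sigma>H \<phi>H \<sigma>\<sigma> \<psi>\<phi>)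
  define S where "S = {x \<in> carrier G. x \<otimes>\<^bsub>G\<^esub> x = \<one>\<^bsub>G\<^esub> \<or> \<alpha> x = inv\<^bsub>G\<^esub> x}"
  define K where "K = generate G S"
  have S: "S \<subseteq> carrier G" by (auto simp: S_def)
  have K: "subgroup K G" unfolding K_def by (rule G.generate_is_subgroup[OF S])
  have KG: "K \<subseteq> carrier G" using K by (rule subgroup.subset)
  \<comment> \<open>Having trivial square is preserved by any homomorphism. If \<alpha> inverts
    \<open>x\<close>, then applying \<alpha> twice gives \<open>x\<close>, which is the inverse of
    the image of \<open>x\<close>.\<close>
  have "\<alpha> ` S \<subseteq> S"
    by (auto simp: S_def \<alpha>\<alpha> simp flip: \<alpha>.hom_mult)
  then have \<alpha>K: "\<alpha> ` K \<subseteq> K"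
    unfolding K_def using \<alpha>.generate_img[OF S] G.mono_generate by metis
  have "\<phi> ` K = H"
  proof (rule \<Gamma>.subgroup_index_2_eq[OF H index gen t])
    have "subgroup (\<phi> ` K) ?H" by (rule \<phi>.subgroup_img_is_subgroup[OF K])
    then show "subgroup (\<phi> ` K) \<Gamma>" by (rule \<Gamma>.incl_subgroup[OF H])
    show "\<phi> ` K \<subseteq> H" using KG \<phi>H by auto
  next
    fix x assume "x \<in> \<phi> ` K"
    then obtain k where k: "k \<in> K" "k \<in> carrier G" "x = \<phi> k" using KG by blast
    then have "\<sigma> x = \<phi> (\<alpha> k)" by (simp add: \<alpha>_def \<phi>\<psi> \<sigma>H \<phi>H)
    then show "t \<otimes>\<^bsub>\<Gamma>\<^esub> x \<otimes>\<^bsub>\<Gamma>\<^esub> t \<in> \<phi> ` K" using k \<alpha>K by (auto simp: \<sigma>_def)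
  next
    fix x assume x: "x \<in> H" "x \<otimes>\<^bsub>\<Gamma>\<^esub> x = \<one>\<^bsub>\<Gamma>\<^esub>"
    have "\<psi> x \<in> S" using \<psi>.hom_mult[of x x] \<psi>.hom_one x by (auto simp: S_def \<psi>G)
    then have "\<psi> x \<in> K" unfolding K_def by (rule generate.incl)
    then show "x \<in> \<phi> ` K" using x \<phi>\<psi> by (metis imageI)
  next
    fix x assume x: "x \<in> H" "t \<otimes>\<^bsub>\<Gamma>\<^esub> x \<otimes>\<^bsub>\<Gamma>\<^esub> t = inv\<^bsub>\<Gamma>\<^esub> x"
    have "\<alpha> (\<psi> x) = \<psi> (inv\<^bsub>?H\<^esub> x)"
      using x \<Gamma>.m_inv_consistent[OF H x(1)] by (simp add: \<alpha>_def \<phi>\<psi> \<sigma>_def)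
    then have "\<psi> x \<in> S" using x \<psi>.hom_inv[of x] by (auto simp: S_def \<psi>G)
    then have "\<psi> x \<in> K" unfolding K_def by (rule generate.incl)
    then show "x \<in> \<phi> ` K" using x \<phi>\<psi> by (metis imageI)
  qed
  then have "x \<in> K" if "x \<in> carrier G" for x
    using \<phi>H[OF that] \<psi>\<phi>[OF that] \<psi>\<phi> KG by (metis (no_types) imageE subsetD)
  then have "generate G S = carrier G"
    using KG unfolding K_def by blast
  then show ?thesis
    unfolding S_def by (intro that[OF \<alpha> \<alpha>\<alpha>])
qed

section \<open>Presented groups\<close>

lemma inv_letter_inv_letter [simp]: "inv_letter (inv_letter x) = x"
  by (simp add: inv_letter_def)

lemma word_eq_append_left: "word_eq R u v \<Longrightarrow> word_eq R (w @ u) (w @ v)"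
proof (induction rule: word_eq.induct)
  case (cancel u x v)
  then show ?case using word_eq.cancel[of R "w @ u" x v] by simp
next
  case (relator r u v)
  then show ?case using word_eq.relator[of r R "w @ u" v] by simp
qed (blast intro: word_eq.intros)+

lemma word_eq_append_right: "word_eq R u v \<Longrightarrow> word_eq R (u @ w) (v @ w)"
proof (induction rule: word_eq.induct)
  case (cancel u x v)
  then show ?case using word_eq.cancel[of R u x "v @ w"] by simp
next
  case (relator r u v)
  then show ?case using word_eq.relator[of r R u "v @ w"] by simp
qed (blast intro: word_eq.intros)+

lemma word_eq_append: "word_eq R u u' \<Longrightarrow> word_eq R v v' \<Longrightarrow> word_eq R (u @ v) (u' @ v')"
  by (meson word_eq.trans word_eq_append_left word_eq_append_right)

lemma word_eq_inv_word: "word_eq R (inv_word w @ w) []"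
proof (induction w)
  case Nil
  then show ?case by (simp add: inv_word_def word_eq.refl)
next
  case (Cons x w)
  \<comment> \<open>The rule \<open>cancel\<close> removes a letter followed by its inverse; taking
    \<open>inv_letter x\<close> as the letter gives the opposite order.\<close>
  have "word_eq R (inv_word w @ [inv_letter x, inv_letter (inv_letter x)] @ w) (inv_word w @ w)"
    by (rule word_eq.cancel)
  then show ?case using Cons by (auto simp: inv_word_def intro: word_eq.trans)
qed

section \<open>Word classes and the group they form\<close>

lemma equiv_word_rel: "equiv UNIV (word_rel R)"
  by (rule equivI)
    (auto simp: word_rel_def refl_on_def intro!: symI transI intro: word_eq.intros)

definition word_class :: "word set \<Rightarrow> word \<Rightarrow> word set" where
  "word_class R w = word_rel R `` {w}"

lemma word_class_eq_iff: "word_class R u = word_class R v \<longleftrightarrow> word_eq R u v"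
  using eq_equiv_class_iff[OF equiv_word_rel[of R]] by (simp add: word_class_def word_rel_def)

lemma carrier_presented_group: "carrier (presented_group R) = range (word_class R)"
  by (auto simp: presented_group_def quotient_def word_class_def)

lemma one_presented_group: "\<one>\<^bsub>presented_group R\<^esub> = word_class R []"
  by (simp add: presented_group_def word_class_def)

text \<open>Concatenation respects \<open>word_eq\<close>, so all classes in the union defining the
  product are the same one.\<close>

lemma mult_word_class:
  "word_class R u \<otimes>\<^bsub>presented_group R\<^esub> word_class R v = word_class R (u @ v)"
proof -
  have "word_class R (u' @ v') = word_class R (u @ v)"
    if "u' \<in> word_class R u" "v' \<in> word_class R v" for u' v'
    using that unfolding word_class_eq_iff
    by (auto simp: word_class_def word_rel_def intro: word_eq.sym word_eq_append)
  moreover have "u \<in> word_class R u" "v \<in> word_class R v"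
    by (auto simp: word_class_def word_rel_def word_eq.refl)
  ultimately have "(\<Union>u'\<in>word_class R u. \<Union>v'\<in>word_class R v. word_class R (u' @ v')) = word_class R (u @ v)"
    by blast
  then show ?thesis
    by (simp add: presented_group_def word_class_mult_def word_class_def)
qed

lemma group_presented_group: "group (presented_group R)"
proof (rule groupI)
  fix x assume "x \<in> carrier (presented_group R)"
  then obtain w where "x = word_class R w" by (auto simp: carrier_presented_group)
  then show "\<exists>y\<in>carrier (presented_group R). y \<otimes>\<^bsub>presented_group R\<^esub> x = \<one>\<^bsub>presented_group R\<^esub>"
    by (intro bexI[of _ "word_class R (inv_word w)"])
      (auto simp: carrier_presented_group mult_word_class one_presented_group word_class_eq_iff
        word_eq_inv_word)
qed (auto simp: carrier_presented_group mult_word_class one_presented_group)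

lemma inv_word_class_letter:
  "inv\<^bsub>presented_group R\<^esub> (word_class R [x]) = word_class R [inv_letter x]"
proof -
  interpret group "presented_group R" by (rule group_presented_group)
  have "word_eq R ([] @ [inv_letter x, inv_letter (inv_letter x)] @ []) ([] @ [])"
    by (rule word_eq.cancel)
  then show ?thesis
    by (intro inv_equality)
      (auto simp: carrier_presented_group mult_word_class one_presented_group word_class_eq_iff)
qed

section \<open>Evaluation of words in a group and the universal property\<close>

definition letter_val :: "('a, 'b) monoid_scheme \<Rightarrow> (gen \<Rightarrow> 'a) \<Rightarrow> letter \<Rightarrow> 'a" where
  "letter_val G f x = (if snd x then inv\<^bsub>G\<^esub> f (fst x) else f (fst x))"

definition word_val :: "('a, 'b) monoid_scheme \<Rightarrow> (gen \<Rightarrow> 'a) \<Rightarrow> word \<Rightarrow> 'a" where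
  "word_val G f w = foldr (\<lambda>x y. letter_val G f x \<otimes>\<^bsub>G\<^esub> y) w \<one>\<^bsub>G\<^esub>"

lemma word_val_Nil [simp]: "word_val G f [] = \<one>\<^bsub>G\<^esub>"
  and word_val_Cons [simp]: "word_val G f (x # w) = letter_val G f x \<otimes>\<^bsub>G\<^esub> word_val G f w"
  by (simp_all add: word_val_def)

context group
begin

lemma letter_val_closed [simp]: "range f \<subseteq> carrier G \<Longrightarrow> letter_val G f x \<in> carrier G"
  by (auto simp: letter_val_def)

lemma word_val_closed [simp]: "range f \<subseteq> carrier G \<Longrightarrow> word_val G f w \<in> carrier G"
  by (induction w) auto

lemma word_val_append:
  "range f \<subseteq> carrier G \<Longrightarrow> word_val G f (u @ v) = word_val G f u \<otimes> word_val G f v"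
  by (induction u) (auto simp: m_assoc)

lemma word_val_replicate:
  "range f \<subseteq> carrier G \<Longrightarrow> word_val G f (replicate k x) = letter_val G f x [^] k"
  by (induction k) (auto simp flip: nat_pow_Suc2 simp del: nat_pow_Suc)

lemma letter_val_inv_letter:
  "range f \<subseteq> carrier G \<Longrightarrow> letter_val G f x \<otimes> letter_val G f (inv_letter x) = \<one>"
  by (auto simp: letter_val_def inv_letter_def image_subset_iff)

text \<open>Free cancellation never changes a value, and relators evaluate to \<open>\<one>\<close>
  by assumption.\<close>

lemma word_val_eq:
  assumes "word_eq R u v" and f: "range f \<subseteq> carrier G"
    and "\<And>r. r \<in> R \<Longrightarrow> word_val G f r = \<one>"
  shows "word_val G f u = word_val G f v"
  using assms(1)
proof (induction rule: word_eq.induct)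
  case (cancel u x v)
  then show ?case
    using f by (simp add: word_val_append letter_val_inv_letter flip: m_assoc)
next
  case (relator r u v)
  then show ?case
    using f assms(3) by (simp add: word_val_append flip: m_assoc)
qed auto

end

text \<open>With this, facts about word values in an arbitrary group apply to the elements of the
  presented group itself.\<close>

lemma word_class_eq_word_val:
  "word_class R w = word_val (presented_group R) (\<lambda>g. word_class R [(g, False)]) w"
proof (induction w)
  case (Cons x w)
  have "word_class R [x] = letter_val (presented_group R) (\<lambda>g. word_class R [(g, False)]) x"
    by (cases x) (auto simp: letter_val_def inv_word_class_letter inv_letter_def)
  then show ?case using Cons mult_word_class[of R "[x]" w] by simp
qed (simp add: one_presented_group)

text \<open>Von Dyck's theorem. The value does not depend on the representative picked by
  \<open>SOME\<close>, by \<open>word_val_eq\<close>.\<close>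

lemma presented_group_hom:
  assumes "group G" and f: "range f \<subseteq> carrier G"
    and rel: "\<And>r. r \<in> R \<Longrightarrow> word_val G f r = \<one>\<^bsub>G\<^esub>"
  obtains \<phi> where "\<phi> \<in> hom (presented_group R) G" "\<And>w. \<phi> (word_class R w) = word_val G f w"
proof -
  interpret group G by fact
  define \<phi> where "\<phi> P = word_val G f (SOME w. P = word_class R w)" for P
  have \<phi>: "\<phi> (word_class R w) = word_val G f w" for w
  proof -
    have "word_class R w = word_class R (SOME v. word_class R w = word_class R v)"
      by (rule someI) (rule HOL.refl)
    then show ?thesis
      unfolding \<phi>_def word_class_eq_iff by (metis word_val_eq f rel)
  qed
  have "\<phi> \<in> hom (presented_group R) G"
    by (rule homI) (auto simp: carrier_presented_group mult_word_class \<phi> f word_val_append)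
  then show ?thesis using that \<phi> by blast
qed

section \<open>Consequences of the defining relations in an arbitrary group\<close>

context group
begin

text \<open>One factor \<open>a\<close> of the commutator is absorbed by the fourth power, leaving
  (a b)^-1 b a^-3. The resulting equation a b a^3 = b is free of inverses, which suits computation
  in the model and the application of homomorphisms.\<close>

lemma word_val_commutator_relator_iff:
  assumes f: "range f \<subseteq> carrier G"
  shows "word_val G f ([(GB, True), (GA, True), (GB, False), (GA, False)] @ replicate 4 (GA, True)) = \<one>
    \<longleftrightarrow> f GA \<otimes> f GB \<otimes> f GA [^] (3::nat) = f GB"
proof -
  let ?x = "f GA" and ?y = "f GB"
  have c: "?x \<in> carrier G" "?y \<in> carrier G" using f by auto
  have x4: "?x \<otimes> inv ?x [^] (4::nat) = inv (?x [^] (3::nat))"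
    using c nat_pow_Suc2[of "inv ?x" 3] by (simp add: nat_pow_inv flip: m_assoc)
  have "word_val G f ([(GB, True), (GA, True), (GB, False), (GA, False)] @ replicate 4 (GA, True))
      = inv ?y \<otimes> (inv ?x \<otimes> (?y \<otimes> inv (?x [^] (3::nat))))"
    unfolding word_val_append[OF f] word_val_replicate[OF f] using c
    by (simp add: letter_val_def m_assoc x4)
  also have "\<dots> = inv (?x \<otimes> ?y) \<otimes> (?y \<otimes> inv (?x [^] (3::nat)))"
    using c by (simp add: inv_mult_group m_assoc)
  also have "\<dots> = \<one> \<longleftrightarrow> ?y \<otimes> inv (?x [^] (3::nat)) = ?x \<otimes> ?y"
    using c by (metis inv_closed inv_solve_left m_closed nat_pow_closed r_one one_closed)
  also have "\<dots> \<longleftrightarrow> ?x \<otimes> ?y \<otimes> ?x [^] (3::nat) = ?y"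
    using c by (metis inv_solve_right m_closed nat_pow_closed)
  finally show ?thesis .
qed

lemma pow_mod_eq:
  assumes "x \<in> carrier G" "x [^] (m::nat) = \<one>"
  shows "x [^] (k mod m) = x [^] k"
proof -
  have "x [^] k = x [^] (m * (k div m) + k mod m)" by simp
  also have "\<dots> = (x [^] m) [^] (k div m) \<otimes> x [^] (k mod m)"
    using assms(1) by (simp only: nat_pow_mult nat_pow_pow)
  also have "\<dots> = x [^] (k mod m)"
    using assms by simp
  finally show ?thesis by simp
qed

text \<open>The relation moves \<open>b\<close> to the left past powers of \<open>a\<close>, so the
  set \<open>N\<close> of products b^k a^l absorbs generators from the right. The finite orders turn
  inverse letters into natural powers.\<close>

lemma word_val_normal_form:
  assumes f: "range f \<subseteq> carrier G" and "0 < m" "0 < n"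
    and x: "f GA [^] (m::nat) = \<one>" and y: "f GB [^] (n::nat) = \<one>"
    and rel: "f GA \<otimes> f GB \<otimes> f GA [^] (3::nat) = f GB"
  shows "\<exists>(k :: nat) (l :: nat). word_val G f w = f GB [^] k \<otimes> f GA [^] l"
proof -
  let ?x = "f GA" and ?y = "f GB"
  define N where "N = {?y [^] k \<otimes> ?x [^] l | (k :: nat) (l :: nat). True}"
  have c: "?x \<in> carrier G" "?y \<in> carrier G" using f by auto
  have inv_pow: "inv z = z [^] (r - 1)" if "z \<in> carrier G" "z [^] r = \<one>" "0 < r" for z and r :: nat
    using that by (intro inv_equality) (auto simp flip: nat_pow_Suc)
  define e where "e = (m - 1) * 3"
  have "?x \<otimes> ?y = ?y \<otimes> inv (?x [^] (3::nat))"
    using rel c by (metis inv_solve_right m_closed nat_pow_closed)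
  also have "inv (?x [^] (3::nat)) = ?x [^] e"
    using c inv_pow[OF c(1) x \<open>0 < m\<close>] by (simp add: e_def nat_pow_pow flip: nat_pow_inv)
  finally have xy: "?x \<otimes> ?y = ?y \<otimes> ?x [^] e" .
  have xly: "?x [^] l \<otimes> ?y = ?y \<otimes> ?x [^] (e * l)" for l :: nat
  proof (induction l)
    case (Suc l)
    have "?x [^] Suc l \<otimes> ?y = ?x [^] l \<otimes> ?y \<otimes> ?x [^] e"
      using c by (simp add: m_assoc xy)
    then show ?case
      using c by (simp add: Suc m_assoc nat_pow_mult add.commute)
  qed (use c in simp)
  have Nx: "p \<otimes> ?x \<in> N" if p: "p \<in> N" for p
  proof -
    obtain k l :: nat where "p = ?y [^] k \<otimes> ?x [^] l" using p by (auto simp: N_def)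
    then have "p \<otimes> ?x = ?y [^] k \<otimes> ?x [^] Suc l" using c by (simp add: m_assoc)
    then show ?thesis unfolding N_def by blast
  qed
  have Ny: "p \<otimes> ?y \<in> N" if p: "p \<in> N" for p
  proof -
    obtain k l :: nat where "p = ?y [^] k \<otimes> ?x [^] l" using p by (auto simp: N_def)
    then have "p \<otimes> ?y = ?y [^] Suc k \<otimes> ?x [^] (e * l)" using c by (simp add: m_assoc xly)
    then show ?thesis unfolding N_def by blast
  qed
  have NG: "N \<subseteq> carrier G" using c by (auto simp: N_def)
  have Npow: "p \<otimes> z [^] r \<in> N"
    if "\<And>p. p \<in> N \<Longrightarrow> p \<otimes> z \<in> N" "z \<in> carrier G" "p \<in> N" for p z and r :: nat
  proof (induction r)
    case 0
    then show ?case using that NG by auto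
  next
    case (Suc r)
    then show ?case using that(1)[OF Suc] that(2,3) NG by (auto simp: m_assoc)
  qed
  have Nletter: "p \<otimes> letter_val G f s \<in> N" if "p \<in> N" for p s
  proof -
    obtain g h where s: "s = (g, h)" by (cases s)
    show ?thesis
      using that Nx Ny Npow[OF Nx c(1) that] Npow[OF Ny c(2) that]
        inv_pow[OF c(1) x \<open>0 < m\<close>] inv_pow[OF c(2) y \<open>0 < n\<close>]
      by (cases g; cases h) (simp_all add: s letter_val_def)
  qed
  have "word_val G f w \<in> N"
  proof (induction w rule: rev_induct)
    case Nil
    have "\<one> = ?y [^] (0::nat) \<otimes> ?x [^] (0::nat)" by simp
    then show ?case unfolding N_def word_val_Nil by blast
  next
    case (snoc s w)
    then show ?case using Nletter[OF snoc] f by (simp add: word_val_append)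
  qed
  then show ?thesis by (auto simp: N_def)
qed

end

section \<open>A concrete model of the group\<close>

text \<open>The pair \<open>(j, i)\<close> encodes \<open>b\<^sup>j a\<^sup>i\<close>; the multiplication comes from \<open>a b = b a\<^sup>-\<^sup>3\<close>.\<close>

definition Gmn_model :: "nat \<Rightarrow> nat \<Rightarrow> (nat \<times> int) monoid" where
  "Gmn_model m n =
     \<lparr> carrier = {..<n} \<times> {0..<int m},
       monoid.mult = (\<lambda>(j, i) (j', i'). ((j + j') mod n, (i * (-3) ^ j' + i') mod int m)),
       monoid.one = (0, 0) \<rparr>"

text \<open>Squaring gains one factor 2: in x^2 - 1 = (x + 1)(x - 1) the first factor is even, as
  \<open>x\<close> is odd.\<close>

lemma neg_three_power_cong: "[(-3) ^ 2 ^ j = (1::int)] (mod 2 ^ (j + 2))"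
proof (induction j)
  case 0
  then show ?case by (simp add: cong_def)
next
  case (Suc j)
  let ?x = "(-3::int) ^ 2 ^ j"
  have "(2::int) dvd ?x + 1" by simp
  moreover have "2 ^ (j + 2) dvd ?x - 1"
    using Suc by (simp add: cong_iff_dvd_diff)
  ultimately have "2 * 2 ^ (j + 2) dvd (?x + 1) * (?x - 1)"
    by (rule mult_dvd_mono)
  also have "(?x + 1) * (?x - 1) = (-3) ^ 2 ^ Suc j - 1"
    by (simp add: algebra_simps power_mult power2_eq_square mult_2 power_add)
  finally show ?case by (simp add: cong_iff_dvd_diff)
qed

lemma neg_three_power_mod_4: "[(-3) ^ k = (1::int)] (mod 4)"
  using cong_pow[of "-3::int" 1 4 k] by (simp add: cong_def)

section \<open>The group axioms for the model\<close>

locale Gmn_parameters =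
  fixes m n :: nat and i j :: nat
  assumes m: "m = 2 ^ i" and n: "n = 2 ^ j" and m_ge: "16 \<le> m" and n_ge: "4 \<le> n"
    and m_le: "m \<le> 4 * n"
begin

abbreviation M where "M \<equiv> Gmn_model m n"

lemma carrier_M: "carrier M = {..<n} \<times> {0..<int m}"
  and mult_M: "(k, x) \<otimes>\<^bsub>M\<^esub> (l, y) = ((k + l) mod n, (x * (-3) ^ l + y) mod int m)"
  and one_M: "\<one>\<^bsub>M\<^esub> = (0, 0)"
  by (simp_all add: Gmn_model_def)

lemma m_pos: "0 < m" and n_pos: "0 < n"
  using m_ge n_ge by auto

lemma sixteen_dvd_m: "16 dvd m"
proof -
  have "(2::nat) ^ 4 \<le> 2 ^ i" using m m_ge by simp
  then have "4 \<le> i" by (subst (asm) power_increasing_iff) auto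
  then have "(2::nat) ^ 4 dvd 2 ^ i" by (rule le_imp_power_dvd)
  then show ?thesis using m by simp
qed

text \<open>Here \<open>m \<le> 4 * n\<close> enters: it makes \<open>m\<close> a divisor of
  2^(j+2), the modulus in \<open>neg_three_power_cong\<close>.\<close>

lemma neg_three_power_n: "[(-3) ^ n = (1::int)] (mod int m)"
proof -
  have "(2::nat) ^ i \<le> 2 ^ (j + 2)" using m n m_le by simp
  then have "i \<le> j + 2" by (subst (asm) power_increasing_iff) auto
  then have "(2::int) ^ i dvd 2 ^ (j + 2)" by (rule le_imp_power_dvd)
  then show ?thesis
    using neg_three_power_cong[of j] cong_dvd_modulus m n by auto
qed

text \<open>This makes the action of b^k on powers of \<open>a\<close> depend only on
  \<open>k\<close> modulo \<open>n\<close>; associativity of the model rests on it.\<close>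

lemma neg_three_power_mod_n: "[(-3) ^ (k mod n) = (-3 :: int) ^ k] (mod int m)"
proof -
  have "(-3::int) ^ k = ((-3) ^ n) ^ (k div n) * (-3) ^ (k mod n)"
    by (simp flip: power_mult power_add)
  moreover have "[((-3) ^ n) ^ (k div n) * (-3) ^ (k mod n) = 1 ^ (k div n) * (-3::int) ^ (k mod n)] (mod int m)"
    by (intro cong_mult cong_pow neg_three_power_n cong_refl)
  ultimately show ?thesis by (simp add: cong_sym)
qed

lemma group_M: "group M"
proof (rule groupI)
  fix p q assume "p \<in> carrier M" "q \<in> carrier M"
  then show "p \<otimes>\<^bsub>M\<^esub> q \<in> carrier M"
    using m_pos n_pos by (auto simp: carrier_M mult_M split: prod.splits)
next
  show "\<one>\<^bsub>M\<^esub> \<in> carrier M" using m_pos n_pos by (simp add: carrier_M one_M)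
next
  fix p q r assume "p \<in> carrier M" "q \<in> carrier M" "r \<in> carrier M"
  obtain k x l y h z where pqr: "p = (k, x)" "q = (l, y)" "r = (h, z)" by (metis surj_pair)
  have "[((x * (-3) ^ l + y) mod int m) * (-3) ^ h + z = (x * (-3) ^ l + y) * (-3) ^ h + z] (mod int m)"
    by (intro cong_add cong_mult cong_refl) simp
  moreover have "[x * (-3) ^ ((l + h) mod n) + (y * (-3) ^ h + z) mod int m
      = x * (-3) ^ (l + h) + (y * (-3) ^ h + z)] (mod int m)"
    by (intro cong_add cong_mult cong_refl neg_three_power_mod_n) simp
  ultimately show "p \<otimes>\<^bsub>M\<^esub> q \<otimes>\<^bsub>M\<^esub> r = p \<otimes>\<^bsub>M\<^esub> (q \<otimes>\<^bsub>M\<^esub> r)"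
    unfolding pqr mult_M by (simp add: cong_def mod_simps power_add algebra_simps)
next
  fix p assume "p \<in> carrier M"
  then show "\<one>\<^bsub>M\<^esub> \<otimes>\<^bsub>M\<^esub> p = p" by (auto simp: carrier_M one_M mult_M)
next
  fix p assume "p \<in> carrier M"
  then obtain k x where p: "p = (k, x)" "k < n" by (auto simp: carrier_M)
  \<comment> \<open>The inverse of b^k a^x is a^-x b^(n-k), with the power of \<open>b\<close> moved
    to the front. The outer \<open>mod n\<close> matters for \<open>k = 0\<close>.\<close>
  define q where "q = ((n - k) mod n, (- x * (-3) ^ (n - k)) mod int m)"
  have "[(- x * (-3) ^ (n - k)) mod int m * (-3) ^ k + x = - x * (-3) ^ (n - k) * (-3) ^ k + x] (mod int m)"
    by (intro cong_add cong_mult cong_refl) simp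
  also have "- x * (-3) ^ (n - k) * (-3) ^ k + x = - x * (-3) ^ n + x"
    using p(2) by (simp flip: power_add add: mult.assoc)
  also have "[- x * (-3) ^ n + x = - x * 1 + x] (mod int m)"
    by (intro cong_add cong_mult cong_refl neg_three_power_n)
  finally have "q \<otimes>\<^bsub>M\<^esub> p = \<one>\<^bsub>M\<^esub>"
    using p(2) by (simp add: q_def p(1) mult_M one_M cong_def mod_simps)
  moreover have "q \<in> carrier M" using m_pos n_pos by (simp add: q_def carrier_M)
  ultimately show "\<exists>q\<in>carrier M. q \<otimes>\<^bsub>M\<^esub> p = \<one>\<^bsub>M\<^esub>" by blast
qed

section \<open>Generators of the model and its isomorphism with the presented group\<close>

sublocale M: group M by (rule group_M)

definition a :: "nat \<times> int" where "a = (0, 1)"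
definition b :: "nat \<times> int" where "b = (1, 0)"

lemma a_in [simp]: "a \<in> carrier M" and b_in [simp]: "b \<in> carrier M"
  using m_ge n_ge by (auto simp: a_def b_def carrier_M)

lemma pow_M_0: "(0, x mod int m) [^]\<^bsub>M\<^esub> k = (0, (int k * x) mod int m)" for k :: nat
  by (induction k) (simp_all add: one_M mult_M mod_simps algebra_simps)

lemma a_pow: "a [^]\<^bsub>M\<^esub> k = (0, int k mod int m)" for k :: nat
  using pow_M_0[of 1 k] m_ge by (simp add: a_def)

lemma b_pow: "b [^]\<^bsub>M\<^esub> k = (k mod n, 0)" for k :: nat
  by (induction k) (simp_all add: one_M b_def mult_M mod_simps)

lemma b_pow_a_pow: "b [^]\<^bsub>M\<^esub> k \<otimes>\<^bsub>M\<^esub> a [^]\<^bsub>M\<^esub> l = (k mod n, int l mod int m)" for k l :: nat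
  by (simp add: a_pow b_pow mult_M)

lemma relation_M: "a \<otimes>\<^bsub>M\<^esub> b \<otimes>\<^bsub>M\<^esub> a [^]\<^bsub>M\<^esub> (3::nat) = b"
  using n_ge by (simp add: a_pow, simp add: a_def b_def mult_M mod_simps)

text \<open>The generators \<open>a\<close>, \<open>b\<close> of the model satisfy the relators,
  which yields \<phi>. It is onto because each pair is some b^k a^l. It is injective because every
  element of the presented group has this form and its image determines \<open>k\<close> modulo
  \<open>n\<close> and \<open>l\<close> modulo \<open>m\<close>.\<close>

lemma Gmn_iso_M: "Gmn m n \<cong> M"
proof -
  let ?R = "Gmn_relators m n"
  let ?P = "presented_group ?R"
  interpret P: group ?P by (rule group_presented_group)
  define f where "f g = (case g of GA \<Rightarrow> a | GB \<Rightarrow> b)" for g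
  define F where "F g = word_class ?R [(g, False)]" for g
  have fc: "range f \<subseteq> carrier M" by (auto simp: f_def split: gen.split)
  have Fc: "range F \<subseteq> carrier ?P" by (auto simp: F_def carrier_presented_group)
  have f_rel: "word_val M f r = \<one>\<^bsub>M\<^esub>" if "r \<in> ?R" for r
    using that unfolding Gmn_relators_def
    by (elim insertE emptyE; clarify)
      (simp_all only: M.word_val_commutator_relator_iff[OF fc] M.word_val_replicate[OF fc]
        letter_val_def, auto simp: f_def relation_M one_M simp: a_pow[of m] b_pow[of n])
  obtain \<phi> where \<phi>: "\<phi> \<in> hom ?P M" and \<phi>_class: "\<And>w. \<phi> (word_class ?R w) = word_val M f w"
    using presented_group_hom[OF group_M fc f_rel] by metis
  interpret \<phi>: group_hom ?P M \<phi> using \<phi> by unfold_locales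
  have val: "word_class ?R w = word_val ?P F w" for w
    unfolding F_def by (rule word_class_eq_word_val)
  have F_rel: "word_val ?P F r = \<one>\<^bsub>?P\<^esub>" if "r \<in> ?R" for r
    using word_eq.relator[OF that, of "[]" "[]"] word_class_eq_iff[of ?R r "[]"]
    by (simp add: one_presented_group flip: val)
  have relators: "replicate m (GA, False) \<in> ?R" "replicate n (GB, False) \<in> ?R"
    "[(GB, True), (GA, True), (GB, False), (GA, False)] @ replicate 4 (GA, True) \<in> ?R"
    by (simp_all add: Gmn_relators_def)
  have FA: "F GA [^]\<^bsub>?P\<^esub> m = \<one>\<^bsub>?P\<^esub>" and FB: "F GB [^]\<^bsub>?P\<^esub> n = \<one>\<^bsub>?P\<^esub>"
    using P.word_val_replicate[OF Fc, of m "(GA, False)"] F_rel[of "replicate m (GA, False)"]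
      P.word_val_replicate[OF Fc, of n "(GB, False)"] F_rel[of "replicate n (GB, False)"] relators(1,2)
    by (simp_all add: letter_val_def)
  have F_comm: "F GA \<otimes>\<^bsub>?P\<^esub> F GB \<otimes>\<^bsub>?P\<^esub> F GA [^]\<^bsub>?P\<^esub> (3::nat) = F GB"
    unfolding P.word_val_commutator_relator_iff[OF Fc, symmetric]
    by (rule F_rel[OF relators(3)])
  have F_in: "F g \<in> carrier ?P" for g using Fc by auto
  have \<phi>F: "\<phi> (F GA) = a" "\<phi> (F GB) = b"
    by (simp_all add: F_def \<phi>_class letter_val_def f_def)
  have \<phi>_nf: "\<phi> (F GB [^]\<^bsub>?P\<^esub> k \<otimes>\<^bsub>?P\<^esub> F GA [^]\<^bsub>?P\<^esub> l) = (k mod n, int (l mod m))" for k l :: nat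
    by (simp add: F_in \<phi>F \<phi>.hom_nat_pow b_pow_a_pow zmod_int)
  have nf: "\<exists>(k :: nat) (l :: nat). p = F GB [^]\<^bsub>?P\<^esub> k \<otimes>\<^bsub>?P\<^esub> F GA [^]\<^bsub>?P\<^esub> l" if p: "p \<in> carrier ?P" for p
  proof -
    obtain w where "p = word_val ?P F w"
      using p by (auto simp: carrier_presented_group val)
    then show ?thesis
      using P.word_val_normal_form[OF Fc m_pos n_pos FA FB F_comm] by blast
  qed
  have "inj_on \<phi> (carrier ?P)"
  proof (rule inj_onI)
    fix p q assume p: "p \<in> carrier ?P" and q: "q \<in> carrier ?P" and eq: "\<phi> p = \<phi> q"
    obtain k l k' l' :: nat where
      "p = F GB [^]\<^bsub>?P\<^esub> k \<otimes>\<^bsub>?P\<^esub> F GA [^]\<^bsub>?P\<^esub> l"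
      "q = F GB [^]\<^bsub>?P\<^esub> k' \<otimes>\<^bsub>?P\<^esub> F GA [^]\<^bsub>?P\<^esub> l'"
      using nf[OF p] nf[OF q] by blast
    with eq show "p = q"
      using P.pow_mod_eq[OF F_in FA] P.pow_mod_eq[OF F_in FB]
      by (simp add: \<phi>_nf) (metis)
  qed
  moreover have "\<phi> ` carrier ?P = carrier M"
  proof
    show "carrier M \<subseteq> \<phi> ` carrier ?P"
    proof
      fix p assume "p \<in> carrier M"
      then obtain k x where p: "p = (k, x)" "k < n" "0 \<le> x" "x < int m" by (auto simp: carrier_M)
      then have "nat x < m" by simp
      then have "p = \<phi> (F GB [^]\<^bsub>?P\<^esub> k \<otimes>\<^bsub>?P\<^esub> F GA [^]\<^bsub>?P\<^esub> nat x)"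
        using p unfolding \<phi>_nf by simp
      then show "p \<in> \<phi> ` carrier ?P" using F_in by (simp del: \<phi>.hom_mult)
    qed
  qed auto
  ultimately have "\<phi> \<in> iso ?P M" using \<phi> by (simp add: iso_iff)
  then show ?thesis unfolding Gmn_def by (rule is_isoI)
qed

lemma card_Gmn: "card (carrier (Gmn m n)) = m * n"
  using iso_same_card[OF Gmn_iso_M] by (simp add: carrier_M card_cartesian_product)

lemma finite_Gmn: "finite (carrier (Gmn m n))"
  using iso_finite[OF Gmn_iso_M] by (simp add: carrier_M)

end

section \<open>Automorphisms of the model\<close>

context Gmn_parameters
begin

text \<open>Together with \<open>snd_mult_mod\<close> this gives the coordinates of the
  abelianization: the exponent of \<open>b\<close> modulo \<open>n\<close> and that of
  \<open>a\<close> modulo 4 are additive. They are used in place of a quotient group.\<close>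

lemma fst_mult_mod: "fst (p \<otimes>\<^bsub>M\<^esub> q) mod n = (fst p + fst q) mod n"
  by (cases p; cases q) (simp add: mult_M)

lemma snd_mult_mod: "snd (p \<otimes>\<^bsub>M\<^esub> q) mod 4 = (snd p + snd q) mod 4"
proof -
  obtain k x l y where pq: "p = (k, x)" "q = (l, y)" by (metis surj_pair)
  have "(4::int) dvd int m" using sixteen_dvd_m by presburger
  then have "snd (p \<otimes>\<^bsub>M\<^esub> q) mod 4 = (x * (-3) ^ l + y) mod 4"
    by (simp add: pq mult_M mod_mod_cancel)
  also have "[x * (-3) ^ l + y = x * 1 + y] (mod 4)"
    by (intro cong_add cong_mult cong_refl neg_three_power_mod_4)
  then have "(x * (-3) ^ l + y) mod 4 = (x + y) mod 4" by (simp add: cong_def)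
  finally show ?thesis by (simp add: pq)
qed

text \<open>The extra summand \<open>r\<close> allows rewriting one product inside a sum of several
  terms.\<close>

lemma dvd_fst_mult: "n dvd fst (p \<otimes>\<^bsub>M\<^esub> q) + r \<longleftrightarrow> n dvd fst p + fst q + r"
  unfolding dvd_eq_mod_eq_0 by (metis fst_mult_mod mod_add_left_eq)

lemma dvd_snd_mult: "4 dvd snd (p \<otimes>\<^bsub>M\<^esub> q) + r \<longleftrightarrow> 4 dvd snd p + snd q + r"
  unfolding dvd_eq_mod_eq_0 by (metis snd_mult_mod mod_add_left_eq)

text \<open>For p = b^k a^x the first coordinate gives \<open>n dvd 2 * k\<close> with
  \<open>k < n\<close>. In the second, (-3)^k + 1 is twice an odd number, so divisibility by 8
  forces 4 to divide \<open>x\<close>.\<close>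

lemma involution_M:
  assumes p: "p \<in> carrier M" and "p \<otimes>\<^bsub>M\<^esub> p = \<one>\<^bsub>M\<^esub>"
  shows "4 dvd snd p" "fst p = 0 \<or> 2 * fst p = n"
proof -
  obtain k x where kx: "p = (k, x)" by (cases p)
  have "((k + k) mod n, (x * (-3) ^ k + x) mod int m) = (0, 0)"
    using assms(2) unfolding kx mult_M one_M .
  then have k: "n dvd k + k" and x: "int m dvd x * (-3) ^ k + x"
    unfolding prod.inject dvd_eq_mod_eq_0 by blast+
  obtain c where "k + k = n * c" using k by (auto elim: dvdE)
  moreover have "k < n" using p by (simp add: kx carrier_M)
  ultimately have "n * c < n * 2" by linarith
  then have "c = 0 \<or> c = 1" by auto
  then show "fst p = 0 \<or> 2 * fst p = n" using \<open>k + k = n * c\<close> by (auto simp: kx)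
  have "(4::int) dvd (-3) ^ k - 1"
    using neg_three_power_mod_4 by (simp add: cong_iff_dvd_diff)
  then obtain d :: int where "(-3) ^ k - 1 = 4 * d" by (elim dvdE)
  then have "x * (-3) ^ k + x = x * (4 * d + 1) + x" by (simp add: algebra_simps)
  then have "x * (-3) ^ k + x = 2 * (x * (2 * d + 1))" by (simp add: algebra_simps)
  moreover have "(2 * 4::int) dvd int m" using sixteen_dvd_m by presburger
  ultimately have "(2 * 4::int) dvd 2 * (x * (2 * d + 1))" using x by (metis dvd_trans)
  then have "4 dvd x * (2 * d + 1)" by (subst (asm) dvd_mult_cancel_left) simp
  moreover have "coprime ((2::int) ^ 2) (2 * d + 1)" by (subst coprime_power_left_iff) simp
  ultimately show "4 dvd snd p" by (simp add: kx coprime_dvd_mult_left_iff)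
qed

text \<open>The derived subgroup, generated by a^4, written as the common kernel of the two
  residues.\<close>

definition D :: "(nat \<times> int) set" where
  "D = {p \<in> carrier M. fst p = 0 \<and> 4 dvd snd p}"

lemma D_mult_closed: "p \<in> D \<Longrightarrow> q \<in> D \<Longrightarrow> p \<otimes>\<^bsub>M\<^esub> q \<in> D"
  using fst_mult_mod[of p q] dvd_snd_mult[of p q 0] M.m_closed[of p q]
  by (auto simp: D_def carrier_M)

lemma D_eq_pow:
  assumes "p \<in> D"
  obtains k :: nat where "p = (a [^]\<^bsub>M\<^esub> (4::nat)) [^]\<^bsub>M\<^esub> k"
proof -
  obtain x where x: "p = (0, x)" "0 \<le> x" "x < int m" "4 dvd x"
    using assms by (cases p) (auto simp: D_def carrier_M)
  then obtain c where "x = 4 * c" by (elim dvdE)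
  then have "p = (a [^]\<^bsub>M\<^esub> (4::nat)) [^]\<^bsub>M\<^esub> nat c"
    using x unfolding M.nat_pow_pow[OF a_in] unfolding a_pow by simp
  then show ?thesis by (rule that)
qed

text \<open>The generator a^4 of \<open>D\<close> is a commutator, so its image is one too and has
  both residues zero.\<close>

lemma hom_D:
  assumes \<alpha>: "\<alpha> \<in> hom M M" and p: "p \<in> D"
  shows "\<alpha> p \<in> D"
proof -
  interpret \<alpha>: group_hom M M \<alpha> using \<alpha> by unfold_locales
  define c where "c = a [^]\<^bsub>M\<^esub> (4::nat)"
  have c: "c \<in> carrier M" by (simp add: c_def)
  \<comment> \<open>The relation [b,a] = a^4 without inverses; taking residues of its image cancels
    everything but the image of \<open>c\<close>.\<close>
  have "a \<otimes>\<^bsub>M\<^esub> b \<otimes>\<^bsub>M\<^esub> c = b \<otimes>\<^bsub>M\<^esub> a"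
    using M.nat_pow_Suc[of a 3] relation_M by (simp add: c_def flip: M.m_assoc)
  then have eq: "\<alpha> a \<otimes>\<^bsub>M\<^esub> \<alpha> b \<otimes>\<^bsub>M\<^esub> \<alpha> c = \<alpha> b \<otimes>\<^bsub>M\<^esub> \<alpha> a"
    using c by (metis \<alpha>.hom_mult M.m_closed a_in b_in)
  have "[fst (\<alpha> a) + fst (\<alpha> b) + fst (\<alpha> c) = fst (\<alpha> a) + fst (\<alpha> b) + 0] (mod n)"
    using arg_cong[OF eq, of "\<lambda>p. fst p mod n"] 
    by (simp add: cong_def fst_mult_mod) (metis add.commute fst_mult_mod mod_add_left_eq)
  then have "n dvd fst (\<alpha> c)" unfolding cong_add_lcancel_nat by (simp add: cong_0_iff)
  moreover have "[snd (\<alpha> a) + snd (\<alpha> b) + snd (\<alpha> c) = snd (\<alpha> a) + snd (\<alpha> b) + 0] (mod 4)"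
    using arg_cong[OF eq, of "\<lambda>p. snd p mod 4"] 
    by (simp add: cong_def snd_mult_mod) (metis add.commute snd_mult_mod mod_add_left_eq)
  then have "4 dvd snd (\<alpha> c)" unfolding cong_add_lcancel by (simp add: cong_0_iff)
  moreover have "fst (\<alpha> c) < n" using \<alpha>.hom_closed[OF c] by (auto simp: carrier_M)
  ultimately have \<alpha>c: "\<alpha> c \<in> D" using \<alpha>.hom_closed[OF c] by (auto simp: D_def elim: dvdE)
  obtain k :: nat where p_eq: "p = c [^]\<^bsub>M\<^esub> k" using D_eq_pow[OF p] unfolding c_def .
  have "\<alpha> c [^]\<^bsub>M\<^esub> k \<in> D" for k :: nat
  proof (induction k)
    case 0
    then show ?case using m_pos n_pos by (simp add: D_def one_M carrier_M)
  qed (simp add: D_mult_closed \<alpha>c)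
  then show ?thesis using c by (simp add: p_eq \<alpha>.hom_nat_pow)
qed

text \<open>The assumptions force the images a^x with \<open>x\<close> odd and b^(n-1) a^y. The
  image of a b a^3 = b then says that b^-1 acts on powers of \<open>a\<close> as \<open>b\<close>
  does, by the exponent -3, whence 9 is congruent to 1 modulo \<open>m\<close>.\<close>

lemma not_inverted_M:
  assumes \<alpha>: "\<alpha> \<in> hom M M"
    and fsta: "n dvd fst (\<alpha> a) + fst a" and snda: "4 dvd snd (\<alpha> a) + snd a"
    and fstb: "n dvd fst (\<alpha> b) + fst b"
  shows False
proof -
  interpret \<alpha>: group_hom M M \<alpha> using \<alpha> by unfold_locales
  obtain k x l y where \<alpha>ab: "\<alpha> a = (k, x)" "\<alpha> b = (l, y)" by (metis surj_pair)
  have "k < n" "l < n"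
    using \<alpha>.hom_closed[OF a_in] \<alpha>.hom_closed[OF b_in] by (auto simp: \<alpha>ab carrier_M)
  moreover have "n dvd k" "n dvd Suc l"
    using fsta fstb unfolding \<alpha>ab by (simp_all add: a_def b_def)
  ultimately have k: "k = 0" and l: "Suc l = n"
    using dvd_imp_le[of n k] dvd_imp_le[of n "Suc l"] by auto
  have "4 dvd x + 1" using snda unfolding \<alpha>ab by (simp add: a_def)
  then have "odd x" by presburger
  then have coprime: "coprime (int m) x" by (simp add: m)
  have xm: "x = x mod int m" using \<alpha>.hom_closed[OF a_in] by (auto simp: \<alpha>ab carrier_M)
  have "\<alpha> a \<otimes>\<^bsub>M\<^esub> \<alpha> b \<otimes>\<^bsub>M\<^esub> \<alpha> a [^]\<^bsub>M\<^esub> (3::nat) = \<alpha> b"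
    using arg_cong[OF relation_M, of \<alpha>] by (simp add: \<alpha>.hom_nat_pow)
  moreover have "\<alpha> a [^]\<^bsub>M\<^esub> (3::nat) = (0, (3 * x) mod int m)"
    using pow_M_0[of x 3] xm by (simp add: \<alpha>ab k)
  ultimately have "(x * (-3) ^ l + y + 3 * x) mod int m = y"
    by (simp add: \<alpha>ab k mult_M mod_simps)
  then have "[x * (-3) ^ l + y + 3 * x = y] (mod int m)" by (metis cong_def mod_mod_trivial)
  then have "int m dvd x * ((-3) ^ l + 3)"
    by (simp add: cong_iff_dvd_diff algebra_simps)
  then have "int m dvd (-3) ^ l + 3" using coprime by (simp add: coprime_dvd_mult_right_iff)
  \<comment> \<open>Multiplying by -3 raises the exponent \<open>l\<close> to \<open>n\<close>,
    where the power is known to be 1 modulo \<open>m\<close>.\<close>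
  then have "int m dvd -3 * ((-3) ^ l + 3)" by (rule dvd_mult)
  also have "-3 * ((-3) ^ l + 3) = (-3::int) ^ n - 9" using l by (simp flip: l)
  finally have "[(-3) ^ n = (9::int)] (mod int m)" by (simp add: cong_iff_dvd_diff)
  then have "[9 = (1::int)] (mod int m)" using neg_three_power_n by (metis cong_sym cong_trans)
  then have "int m dvd 8" by (simp add: cong_iff_dvd_diff)
  then show False using m_ge zdvd_imp_le[of "int m" 8] by simp
qed

text \<open>The elements that \<alpha> inverts modulo \<open>D\<close> form a subgroup
  \<open>K\<close>, because the quotient by \<open>D\<close> is abelian. It contains the generating
  set provided by \<open>star_witness_automorphism\<close>, hence \<open>a\<close> and
  \<open>b\<close>, against \<open>not_inverted_M\<close>.\<close>

lemma not_star_witness_M: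
  fixes \<Gamma> :: "'g monoid"
  shows "\<not> star_witness M \<Gamma>"
proof
  assume "star_witness M \<Gamma>"
  then obtain \<alpha> where \<alpha>: "\<alpha> \<in> hom M M" and \<alpha>\<alpha>: "\<And>p. p \<in> carrier M \<Longrightarrow> \<alpha> (\<alpha> p) = p"
    and gen: "generate M {p \<in> carrier M. p \<otimes>\<^bsub>M\<^esub> p = \<one>\<^bsub>M\<^esub> \<or> \<alpha> p = inv\<^bsub>M\<^esub> p} = carrier M"
    by (rule star_witness_automorphism[OF group_M]) (rule that)
  interpret \<alpha>: group_hom M M \<alpha> using \<alpha> by unfold_locales
  define K where "K = {p \<in> carrier M. n dvd fst (\<alpha> p) + fst p \<and> 4 dvd snd (\<alpha> p) + snd p}"
  have inv_dvd: "n dvd fst (inv\<^bsub>M\<^esub> p) + fst p" "4 dvd snd (inv\<^bsub>M\<^esub> p) + snd p"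
    if "p \<in> carrier M" for p
    using dvd_fst_mult[of "inv\<^bsub>M\<^esub> p" p 0] dvd_snd_mult[of "inv\<^bsub>M\<^esub> p" p 0] that by (auto simp: one_M)
  have "subgroup K M"
  proof (rule M.subgroupI)
    show "K \<subseteq> carrier M" by (auto simp: K_def)
    have "\<one>\<^bsub>M\<^esub> \<in> K" using \<alpha>.hom_one by (simp add: K_def) (simp add: one_M)
    then show "K \<noteq> {}" by blast
  next
    fix p assume p: "p \<in> K"
    then have pc: "p \<in> carrier M" by (simp add: K_def)
    define q where "q = inv\<^bsub>M\<^esub> p"
    have q: "q \<in> carrier M" "\<alpha> q = inv\<^bsub>M\<^esub> (\<alpha> p)" using pc by (simp_all add: q_def)
    have "n dvd (fst (\<alpha> q) + fst (\<alpha> p)) + (fst q + fst p)"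
      using inv_dvd[OF pc] inv_dvd[OF \<alpha>.hom_closed[OF pc]] q by (simp add: q_def)
    then have "n dvd (fst (\<alpha> p) + fst p) + (fst (\<alpha> q) + fst q)" by (simp add: ac_simps)
    moreover have "4 dvd (snd (\<alpha> q) + snd (\<alpha> p)) + (snd q + snd p)"
      using inv_dvd[OF pc] inv_dvd[OF \<alpha>.hom_closed[OF pc]] q by (simp add: q_def)
    then have "4 dvd (snd (\<alpha> p) + snd p) + (snd (\<alpha> q) + snd q)" by (simp add: ac_simps)
    ultimately show "inv\<^bsub>M\<^esub> p \<in> K"
      using p q(1) unfolding q_def[symmetric] K_def by (simp add: dvd_add_right_iff)
  next
    fix p q assume pq: "p \<in> K" "q \<in> K"
    then have c: "p \<in> carrier M" "q \<in> carrier M" by (auto simp: K_def)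
    have "n dvd (fst (\<alpha> p) + fst p) + (fst (\<alpha> q) + fst q)"
      "4 dvd (snd (\<alpha> p) + snd p) + (snd (\<alpha> q) + snd q)"
      using pq unfolding K_def by (auto intro: dvd_add)
    then have "n dvd fst (\<alpha> p) + fst (\<alpha> q) + (fst p + fst q)"
      "4 dvd snd (\<alpha> p) + snd (\<alpha> q) + (snd p + snd q)" by (simp_all add: ac_simps)
    then have "n dvd fst (\<alpha> (p \<otimes>\<^bsub>M\<^esub> q)) + fst (p \<otimes>\<^bsub>M\<^esub> q)"
      "4 dvd snd (\<alpha> (p \<otimes>\<^bsub>M\<^esub> q)) + snd (p \<otimes>\<^bsub>M\<^esub> q)"
      using c dvd_fst_mult[of "\<alpha> p" "\<alpha> q"] dvd_fst_mult[of p q] dvd_snd_mult[of "\<alpha> p" "\<alpha> q"]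
        dvd_snd_mult[of p q] by (simp_all add: add.commute)
    then show "p \<otimes>\<^bsub>M\<^esub> q \<in> K" using c by (simp add: K_def)
  qed
  moreover have "p \<in> K" if p: "p \<in> carrier M" "p \<otimes>\<^bsub>M\<^esub> p = \<one>\<^bsub>M\<^esub>" for p
  proof -
    have ap: "\<alpha> p \<in> carrier M" "\<alpha> p \<otimes>\<^bsub>M\<^esub> \<alpha> p = \<one>\<^bsub>M\<^esub>"
      using p by (simp_all flip: \<alpha>.hom_mult)
    note inv = involution_M[OF p] involution_M[OF ap]
    \<comment> \<open>Both first coordinates are 0 or n/2. Since \<alpha> is its own inverse and
      preserves \<open>D\<close>, they are zero together, so their sum is 0 or
      \<open>n\<close>.\<close>
    have "p \<in> D \<longleftrightarrow> \<alpha> p \<in> D"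
      using hom_D[OF \<alpha>] \<alpha>\<alpha>[OF p(1)] by metis
    then have "fst p = 0 \<longleftrightarrow> fst (\<alpha> p) = 0" using p(1) ap(1) inv by (simp add: D_def)
    then have "fst (\<alpha> p) + fst p = 0 \<or> fst (\<alpha> p) + fst p = n" using inv by arith
    then have "n dvd fst (\<alpha> p) + fst p" by auto
    then show ?thesis using p(1) inv by (simp add: K_def)
  qed
  moreover have "p \<in> K" if "p \<in> carrier M" "\<alpha> p = inv\<^bsub>M\<^esub> p" for p
    using inv_dvd[OF that(1)] that by (simp add: K_def)
  ultimately have "carrier M \<subseteq> K"
    using M.generate_subgroup_incl[of "{p \<in> carrier M. p \<otimes>\<^bsub>M\<^esub> p = \<one>\<^bsub>M\<^esub> \<or> \<alpha> p = inv\<^bsub>M\<^esub> p}" K]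
    unfolding gen by blast
  then have "a \<in> K" "b \<in> K" by auto
  then show False using not_inverted_M[OF \<alpha>] by (simp add: K_def)
qed

section \<open>Transfer to the presented groups and the infinite family\<close>

lemma group_Gmn: "group (Gmn m n)"
  unfolding Gmn_def by (rule group_presented_group)

text \<open>A witness for one group is a witness for every isomorphic group.\<close>

lemma not_star_witness_Gmn:
  fixes \<Gamma> :: "'g monoid"
  shows "\<not> star_witness (Gmn m n) \<Gamma>"
proof -
  have "M \<cong> Gmn m n" by (rule group.iso_sym[OF group_Gmn Gmn_iso_M])
  then show ?thesis
    using not_star_witness_M[of \<Gamma>] unfolding star_witness_def by (meson iso_trans)
qed

end

text \<open>The infinitude is expressed through the set of orders: groups of different orders are
  not isomorphic.\<close>

theorem mainTheorem1:
  shows "(\<forall>m n i j. m = 2 ^ i \<and> n = 2 ^ j \<and> 16 \<le> m \<and> 4 \<le> n \<and> m \<le> 4 * n \<longrightarrow>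
            group (Gmn m n) \<and> finite (carrier (Gmn m n)) \<and>
            (\<exists>k. card (carrier (Gmn m n)) = 2 ^ k) \<and>
            (\<forall>\<Gamma> :: 'g monoid. \<not> star_witness (Gmn m n) \<Gamma>))
       \<and> infinite {card (carrier (Gmn m n)) | m n i j.
            m = 2 ^ i \<and> n = 2 ^ j \<and> 16 \<le> m \<and> 4 \<le> n \<and> m \<le> 4 * n}"
proof (intro conjI allI impI)
  fix m n i j :: nat
  assume mn: "m = 2 ^ i \<and> n = 2 ^ j \<and> 16 \<le> m \<and> 4 \<le> n \<and> m \<le> 4 * n"
  then interpret Gmn_parameters m n i j by unfold_locales auto
  show "group (Gmn m n)" by (rule group_Gmn)
  show "finite (carrier (Gmn m n))" by (rule finite_Gmn)
  show "\<exists>k. card (carrier (Gmn m n)) = 2 ^ k"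
    using mn unfolding card_Gmn by (intro exI[of _ "i + j"]) (simp only: power_add)
  show "\<not> star_witness (Gmn m n) \<Gamma>" for \<Gamma> :: "'g monoid"
    by (rule not_star_witness_Gmn)
next
  let ?S = "{card (carrier (Gmn m n)) | m n i j.
            m = 2 ^ i \<and> n = 2 ^ j \<and> 16 \<le> m \<and> 4 \<le> n \<and> m \<le> 4 * n}"
  \<comment> \<open>The orders come from \<open>m = 16\<close> and n = 2^(j+2), which satisfy all
    the constraints for every \<open>j\<close>.\<close>
  have "(2::nat) ^ (j + 6) \<in> ?S" for j
  proof -
    have "(2::nat) ^ 2 \<le> 2 ^ (j + 2)" by (rule power_increasing) auto
    then have four_le: "(4::nat) \<le> 2 ^ (j + 2)" by simp
    then interpret Gmn_parameters "2 ^ 4" "2 ^ (j + 2)" 4 "j + 2" by unfold_locales auto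
    have "(2::nat) ^ (j + 6) = card (carrier (Gmn (2 ^ 4) (2 ^ (j + 2))))"
      unfolding card_Gmn by (simp add: power_add)
    moreover have "(16::nat) \<le> 2 ^ 4" "(2::nat) ^ 4 \<le> 4 * 2 ^ (j + 2)" using four_le by simp_all
    ultimately show ?thesis
      using four_le by (intro CollectI exI conjI) (rule HOL.refl | assumption)+
  qed
  then have "range (\<lambda>j. (2::nat) ^ (j + 6)) \<subseteq> ?S" by blast
  moreover have "infinite (range (\<lambda>j. (2::nat) ^ (j + 6)))"
    by (rule range_inj_infinite) (rule injI, simp)
  ultimately show "infinite ?S" by (rule infinite_super)
qed

end
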